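(* Let $G$ be a connected graph of order $n\ge 2$. For any real number $k\in[1,\kappa(G)]$, $$k\le\dim_f^k(G)\le\frac{kn}{\kappa(G)},$$ and both bounds are sharp (i.e., each of the two inequalities is attained with equality for some connected graph $G$ and some $k\in[1,\kappa(G)]$).
   Context: All graphs are finite, simple and undirected; the order of $G$ is $|V(G)|$. $d(x,y)$ is the length of a shortest path between $x$ and $y$ in $G$. For distinct $x,y\in V(G)$, let $R\{x,y\}=\{z\in V(G): d(x,z)\neq d(y,z)\}$, and let $\kappa(G)=\min\{|R\{x,y\}|: x\neq y,\ x,y\in V(G)\}$. For a function $g$ on $V(G)$ and $U\subseteq V(G)$, write $g(U)=\sum_{s\in U}g(s)$. For a real number $k\in[1,\kappa(G)]$, a function $g:V(G)\to[0,1]$ is a $k$-resolving function of $G$ if $g(R\{x,y\})\ge k$ for any two distinct vertices $x,y\in V(G)$; the fractional $k$-metric dimension is $\dim_f^k(G)=\min\{g(V(G)): g \text{ is a } k\text{-resolving function of } G\}$. *)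

theory Defs
  imports "Graph_Theory.Graph_Theory" "HOL-Analysis.Analysis"
begin

text \<open>
  A finite simple undirected graph is a \<open>pair_graph\<close>, that is, a finite loopfree digraph with a
  symmetric arc relation; each edge is represented by its two opposite arcs. Since
  the topological \<open>connected\<close> shadows the graph-theoretic one, the latter is written \<open>Digraph_Component.connected\<close>.
\<close>

definition connected_graph :: "'a pair_pre_digraph \<Rightarrow> bool" where
  "connected_graph G \<longleftrightarrow> pair_graph G \<and> Digraph_Component.connected (with_proj G)"

text \<open>
  \<open>\<mu>\<close> is the least cost of a walk from \<open>x\<close> to \<open>y\<close>. Every arc has cost 1, so the cost of a walk is
  its length.
\<close>

definition gdist :: "'a pair_pre_digraph \<Rightarrow> 'a \<Rightarrow> 'a \<Rightarrow> ereal" where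
  "gdist G x y = wf_digraph.\<mu> (with_proj G) (\<lambda>_. 1) x y"

definition resolving_set :: "'a pair_pre_digraph \<Rightarrow> 'a \<Rightarrow> 'a \<Rightarrow> 'a set" where
  "resolving_set G x y = {z \<in> pverts G. gdist G x z \<noteq> gdist G y z}"

text \<open>Meaningful for finite graphs of order at least 2: the set is then finite and nonempty.\<close>

definition kappa :: "'a pair_pre_digraph \<Rightarrow> nat" where
  "kappa G = Min {card (resolving_set G x y) | x y. x \<in> pverts G \<and> y \<in> pverts G \<and> x \<noteq> y}"

definition k_resolving_function :: "'a pair_pre_digraph \<Rightarrow> real \<Rightarrow> ('a \<Rightarrow> real) \<Rightarrow> bool" where
  "k_resolving_function G k g \<longleftrightarrow>
     (\<forall>v \<in> pverts G. 0 \<le> g v \<and> g v \<le> 1) \<and>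
     (\<forall>x \<in> pverts G. \<forall>y \<in> pverts G. x \<noteq> y \<longrightarrow> k \<le> sum g (resolving_set G x y))"

text \<open>
  The minimum ranges over an infinite set of reals. \<open>LEAST\<close> denotes the least element only if
  it exists, so unlike an infimum it does not hide the question whether the minimum is attained.
\<close>

definition frac_k_metric_dim :: "real \<Rightarrow> 'a pair_pre_digraph \<Rightarrow> real" where
  "frac_k_metric_dim k G =
     (LEAST r. \<exists>g. k_resolving_function G k g \<and> r = sum g (pverts G))"

end

theory Submission
  imports Defs
begin

text \<open>
  The constant function \<open>k / \<kappa>(G)\<close> is a \<open>k\<close>-resolving function, and the total weight of a
  \<open>k\<close>-resolving function is at least its weight on a single \<open>R{x, y}\<close>. By compactness of the cube
  \<open>[0, 1]\<^bsup>V\<^esup>\<close> the minimum is attained. Since \<open>R{x, y}\<close> always contains \<open>x\<close> and \<open>y\<close>,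
  the graph \<open>K\<^sub>2\<close> has \<open>\<kappa> = n = 2\<close>, so the two bounds coincide there.
\<close>

lemma (in wf_digraph) \<mu>_refl_unit_weight:
  assumes "x \<in> verts G"
  shows "\<mu> (\<lambda>_. 1) x x = 0"
proof (rule antisym)
  have "awalk x [] x"
    using assms by (simp add: awalk_Nil_iff)
  then show "\<mu> (\<lambda>_. 1) x x \<le> 0"
    using min_cost_le_walk_cost[of x "[]" x "\<lambda>_. 1"] by (simp add: zero_ereal_def)
  show "0 \<le> \<mu> (\<lambda>_. 1) x x"
    unfolding \<mu>_def by (auto intro!: INF_greatest simp: awalk_cost_def sum_list_triv)
qed

text \<open>A walk between distinct vertices uses at least one arc. If there is no such walk, the
  infimum is infinite and the claim still holds.\<close>

lemma (in wf_digraph) \<mu>_unit_weight_pos: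
  assumes "x \<noteq> y"
  shows "0 < \<mu> (\<lambda>_. 1) x y"
proof -
  \<comment> \<open>An infimum of positive costs could be 0, so the uniform bound 1 is proved
    first.\<close>
  have "1 \<le> \<mu> (\<lambda>_. 1) x y"
    unfolding \<mu>_def
  proof (rule INF_greatest)
    fix p assume "p \<in> {p. awalk x p y}"
    with assms have "p \<noteq> []"
      by (auto simp: awalk_Nil_iff)
    then have "1 \<le> length p"
      by (simp add: Suc_le_eq)
    then show "1 \<le> ereal (awalk_cost (\<lambda>_. 1) p)"
      by (simp add: awalk_cost_def sum_list_triv one_ereal_def)
  qed
  then show ?thesis
    by (rule less_le_trans[rotated]) simp
qed

lemma connected_graphD:
  assumes "connected_graph G"
  shows "finite (pverts G)" "wf_digraph (with_proj G)"
proof -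
  interpret pair_graph G
    using assms by (simp add: connected_graph_def)
  show "finite (pverts G)" "wf_digraph (with_proj G)"
    by (rule pair_finite_verts, rule wf_digraph_axioms)
qed

text \<open>Each endpoint is at distance 0 from itself and at positive distance from the other. This
  fact determines \<open>kappa K2\<close>.\<close>

lemma endpoints_in_resolving_set:
  assumes "connected_graph G" "x \<in> pverts G" "y \<in> pverts G" "x \<noteq> y"
  shows "{x, y} \<subseteq> resolving_set G x y"
proof -
  interpret wf_digraph "with_proj G"
    using connected_graphD(2)[OF assms(1)] .
  show ?thesis
    using assms \<mu>_refl_unit_weight[of x] \<mu>_refl_unit_weight[of y]
      \<mu>_unit_weight_pos[of x y] \<mu>_unit_weight_pos[of y x]
    by (auto simp: resolving_set_def gdist_def)
qed

lemma kappa_le_card_resolving_set: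
  assumes "finite (pverts G)" "x \<in> pverts G" "y \<in> pverts G" "x \<noteq> y"
  shows "kappa G \<le> card (resolving_set G x y)"
proof -
  let ?S = "{card (resolving_set G x y) | x y. x \<in> pverts G \<and> y \<in> pverts G \<and> x \<noteq> y}"
  \<comment> \<open>\<open>Min_le\<close> needs a finite set; an image of the finite set of vertex
    pairs provides one.\<close>
  have "?S \<subseteq> (\<lambda>(x, y). card (resolving_set G x y)) ` (pverts G \<times> pverts G)"
    by auto
  then have "finite ?S"
    by (rule finite_subset) (simp add: assms(1))
  then show ?thesis
    unfolding kappa_def by (rule Min_le) (use assms in blast)
qed

text \<open>The bound \<open>k \<le> real (kappa G)\<close> keeps the constant at most 1, and at
  least \<open>kappa G\<close> vertices contribute to each sum, giving at least
  \<open>k\<close>.\<close>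

lemma k_resolving_function_const:
  assumes "finite (pverts G)" "0 \<le> k" "k \<le> real (kappa G)" "0 < kappa G"
  shows "k_resolving_function G k (\<lambda>_. k / real (kappa G))"
  unfolding k_resolving_function_def
proof (intro conjI ballI impI)
  fix x y assume "x \<in> pverts G" "y \<in> pverts G" "x \<noteq> y"
  then have "kappa G \<le> card (resolving_set G x y)"
    by (rule kappa_le_card_resolving_set[OF assms(1)])
  then have "real (kappa G) * (k / real (kappa G))
      \<le> real (card (resolving_set G x y)) * (k / real (kappa G))"
    using assms by (intro mult_right_mono) auto
  then show "k \<le> (\<Sum>_\<in>resolving_set G x y. k / real (kappa G))"
    using assms by simp
qed (use assms in auto)

text \<open>One pair of distinct vertices suffices: its resolving set already carries weight
  \<open>k\<close>, and the other vertices add nonnegative weight.\<close>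

lemma k_resolving_function_weight_ge:
  assumes "finite (pverts G)" "2 \<le> card (pverts G)" "k_resolving_function G k g"
  shows "k \<le> sum g (pverts G)"
proof -
  obtain x y where xy: "x \<in> pverts G" "y \<in> pverts G" "x \<noteq> y"
    using assms(2) by (auto simp: numeral_2_eq_2 card_le_Suc_iff)
  have "k \<le> sum g (resolving_set G x y)"
    using assms(3) xy by (auto simp: k_resolving_function_def)
  also have "\<dots> \<le> sum g (pverts G)"
    using assms by (intro sum_mono2) (auto simp: k_resolving_function_def resolving_set_def)
  finally show ?thesis .
qed

text \<open>Tychonoff's theorem. The cube is indexed by the whole type, which may be infinite, so
  the topology on functions is the product topology.\<close>

lemma compact_unit_cube: "compact {g :: 'a \<Rightarrow> real. \<forall>v. 0 \<le> g v \<and> g v \<le> 1}"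
proof -
  have "{g :: 'a \<Rightarrow> real. \<forall>v. 0 \<le> g v \<and> g v \<le> 1} = PiE UNIV (\<lambda>_. {0..1})"
    by (auto simp: PiE_UNIV_domain)
  moreover have "compactin (product_topology (\<lambda>_::'a. euclidean) UNIV) (PiE UNIV (\<lambda>_. {0..1::real}))"
    by (simp add: compactin_PiE)
  ultimately show ?thesis
    by (simp add: euclidean_product_topology)
qed

text \<open>The total weight is continuous, so it attains its minimum on a nonempty compact set of
  \<open>k\<close>-resolving functions.\<close>

lemma minimal_k_resolving_function_exists:
  assumes fin: "finite (pverts G)" and ex: "k_resolving_function G k g\<^sub>0"
  obtains g where "k_resolving_function G k g"
    and "\<And>h. k_resolving_function G k h \<Longrightarrow> sum g (pverts G) \<le> sum h (pverts G)"
proof -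
  define C where "C = {g :: 'a \<Rightarrow> real. \<forall>v. 0 \<le> g v \<and> g v \<le> 1}"
  define K where "K = C \<inter> {g. k_resolving_function G k g}"
  \<comment> \<open>Values off \<open>pverts G\<close> are unconstrained. Setting them to 0 moves a
    \<open>k\<close>-resolving function into the cube without changing any relevant sum.\<close>
  define r where "r = (\<lambda>(g :: 'a \<Rightarrow> real) v. if v \<in> pverts G then g v else 0)"
  have r_K: "r h \<in> K" and r_sum: "sum (r h) (pverts G) = sum h (pverts G)"
    if h: "k_resolving_function G k h" for h
  proof -
    have "sum (r h) (resolving_set G x y) = sum h (resolving_set G x y)" for x y
      by (rule sum.cong) (auto simp: r_def resolving_set_def)
    then show "r h \<in> K"
      using h by (auto simp: K_def C_def k_resolving_function_def r_def)
    show "sum (r h) (pverts G) = sum h (pverts G)"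
      by (rule sum.cong) (auto simp: r_def)
  qed
  have cont: "continuous_on UNIV (\<lambda>g :: 'a \<Rightarrow> real. sum g A)" for A
    by (intro continuous_on_sum continuous_on_product_coordinates)
  \<comment> \<open>\<open>K\<close> is the compact cube cut by closed half-spaces, one for each
    ordered pair of distinct vertices.\<close>
  have "K = C \<inter> (\<Inter>x\<in>pverts G. \<Inter>y\<in>pverts G - {x}. {g. k \<le> sum g (resolving_set G x y)})"
    by (auto simp: K_def C_def k_resolving_function_def)
  moreover have "compact \<dots>"
    unfolding C_def
    by (intro compact_Int_closed compact_unit_cube closed_INT ballI closed_Collect_le
        cont continuous_on_const)
  ultimately have "compact K"
    by simp
  moreover have "K \<noteq> {}"
    using r_K[OF ex] by blast
  moreover have "continuous_on K (\<lambda>g. sum g (pverts G))"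
    using cont continuous_on_subset by blast
  ultimately obtain g where g: "g \<in> K" "\<And>h. h \<in> K \<Longrightarrow> sum g (pverts G) \<le> sum h (pverts G)"
    using continuous_attains_inf by metis
  show thesis
  proof
    show "k_resolving_function G k g"
      using g(1) by (simp add: K_def)
    show "sum g (pverts G) \<le> sum h (pverts G)" if "k_resolving_function G k h" for h
      using g(2)[OF r_K[OF that]] r_sum[OF that] by simp
  qed
qed

lemma frac_k_metric_dim_bounds:
  assumes "connected_graph G" "2 \<le> card (pverts G)" "k \<in> {1..real (kappa G)}"
  shows "k \<le> frac_k_metric_dim k G"
    and "frac_k_metric_dim k G \<le> k * real (card (pverts G)) / real (kappa G)"
proof -
  have fin: "finite (pverts G)"
    using connected_graphD(1)[OF assms(1)] .
  \<comment> \<open>Here \<open>1 \<le> k\<close> and \<open>k \<le> real (kappa G)\<close> force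
    \<open>kappa G\<close> to be positive, so the quotient is a genuine one.\<close>
  have const: "k_resolving_function G k (\<lambda>_. k / real (kappa G))"
    using assms(3) by (intro k_resolving_function_const fin) auto
  obtain g where g: "k_resolving_function G k g"
    and min: "\<And>h. k_resolving_function G k h \<Longrightarrow> sum g (pverts G) \<le> sum h (pverts G)"
    using minimal_k_resolving_function_exists[OF fin const] by blast
  \<comment> \<open>Since the minimum is attained by \<open>g\<close>, \<open>LEAST\<close> denotes
    exactly this weight.\<close>
  have "frac_k_metric_dim k G = sum g (pverts G)"
    unfolding frac_k_metric_dim_def using g min by (intro Least_equality) auto
  then show "k \<le> frac_k_metric_dim k G"
    and "frac_k_metric_dim k G \<le> k * real (card (pverts G)) / real (kappa G)"
    using k_resolving_function_weight_ge[OF fin assms(2) g] min[OF const]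
    by (simp_all add: mult.commute)
qed

definition K2 :: "nat pair_pre_digraph" where
  "K2 = \<lparr>pverts = {0, 1}, parcs = {(0, 1), (1, 0)}\<rparr>"

lemma connected_graph_K2: "connected_graph K2"
proof -
  have graph: "pair_graph K2"
    by unfold_locales (auto simp: K2_def arcs_ends_def arc_to_ends_def symmetric_def sym_def)
  then interpret pair_graph K2 .
  have "strongly_connected (with_proj K2)"
  proof (rule strongly_connectedI)
    fix u v assume "u \<in> verts (with_proj K2)" "v \<in> verts (with_proj K2)"
    then have "u = v \<or> (u, v) \<in> parcs K2"
      by (auto simp: K2_def)
    then show "u \<rightarrow>\<^sup>*\<^bsub>with_proj K2\<^esub> v"
      using \<open>u \<in> verts (with_proj K2)\<close> by auto
  qed (simp add: K2_def)
  \<comment> \<open>Connectedness means strong connectedness of the symmetric closure, and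
    \<open>K2\<close> is its own symmetric closure.\<close>
  moreover have "mk_symmetric (with_proj K2) = K2"
    by (auto simp: mk_symmetric_def K2_def)
  ultimately show ?thesis
    using graph by (simp add: connected_graph_def Digraph_Component.connected_def)
qed

text \<open>The two endpoints of the only edge already exhaust the vertex set, so every resolving
  set is all of it.\<close>

lemma kappa_K2: "kappa K2 = 2"
proof -
  have R: "resolving_set K2 x y = {0, 1}" if "x \<in> pverts K2" "y \<in> pverts K2" "x \<noteq> y" for x y
    using endpoints_in_resolving_set[OF connected_graph_K2 that] that
    by (auto simp: K2_def resolving_set_def)
  have "{card (resolving_set K2 x y) | x y. x \<in> pverts K2 \<and> y \<in> pverts K2 \<and> x \<noteq> y} = {2}"
  proof (intro set_eqI iffI)
    fix c :: nat assume "c \<in> {2}"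
    moreover have "0 \<in> pverts K2" "1 \<in> pverts K2"
      by (simp_all add: K2_def)
    ultimately show "c \<in> {card (resolving_set K2 x y) | x y. x \<in> pverts K2 \<and> y \<in> pverts K2 \<and> x \<noteq> y}"
      using R[of 0 1] by (intro CollectI exI[of _ 0] exI[of _ 1]) simp
  qed (use R in auto)
  then show ?thesis
    by (simp add: kappa_def)
qed

theorem proposition3p3:
  shows "(\<forall>(G :: 'a pair_pre_digraph) (k :: real).
            connected_graph G \<and> 2 \<le> card (pverts G) \<and> k \<in> {1..real (kappa G)} \<longrightarrow>
              k \<le> frac_k_metric_dim k G \<and>
              frac_k_metric_dim k G \<le> k * real (card (pverts G)) / real (kappa G))
       \<and> (\<exists>(G :: nat pair_pre_digraph) (k :: real).
            connected_graph G \<and> 2 \<le> card (pverts G) \<and> k \<in> {1..real (kappa G)} \<and>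
              frac_k_metric_dim k G = k)
       \<and> (\<exists>(G :: nat pair_pre_digraph) (k :: real).
            connected_graph G \<and> 2 \<le> card (pverts G) \<and> k \<in> {1..real (kappa G)} \<and>
              frac_k_metric_dim k G = k * real (card (pverts G)) / real (kappa G))"
proof -
  have K2: "connected_graph K2" "2 \<le> card (pverts K2)" "1 \<in> {1..real (kappa K2)}"
    using connected_graph_K2 kappa_K2 by (simp_all add: K2_def)
  have card: "card (pverts K2) = 2"
    by (simp add: K2_def)
  have dim: "frac_k_metric_dim 1 K2 = 1"
    \<comment> \<open>For \<open>k = 1\<close> the lower bound is 1 and the upper bound is
      \<open>1 * 2 / 2\<close>, which pins the dimension down.\<close>
    using frac_k_metric_dim_bounds[OF K2] by (simp add: card kappa_K2)
  have dim': "frac_k_metric_dim 1 K2 = 1 * real (card (pverts K2)) / real (kappa K2)"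
    by (simp add: dim card kappa_K2)
  show ?thesis
  proof (intro conjI allI impI)
    fix G :: "'a pair_pre_digraph" and k :: real
    assume "connected_graph G \<and> 2 \<le> card (pverts G) \<and> k \<in> {1..real (kappa G)}"
    then show "k \<le> frac_k_metric_dim k G"
      "frac_k_metric_dim k G \<le> k * real (card (pverts G)) / real (kappa G)"
      by (simp_all only: frac_k_metric_dim_bounds)
  qed (intro exI[of _ K2] exI[of _ 1] conjI K2 dim dim')+
qed

end
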